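(* Let $q\ge 1$, $\varphi>0$, let $x,y\ge 0$ be real numbers that are not both $0$, and let $w=(w_1,\dots,w_n)^T$ be a weight vector with $w_i\in[0,1]$ and $\sum_{i=1}^n w_i=1$. Let $a_i=\langle[u_i^-,u_i^+],[v_i^-,v_i^+]\rangle$ and $a_i'=\langle[u_i^{-\prime},u_i^{+\prime}],[v_i^{-\prime},v_i^{+\prime}]\rangle$ ($i=1,\dots,n$) be two families of interval valued $q$-rung orthopair fuzzy numbers such that, for all $i$, $u_i^-\le u_i^{-\prime}$, $u_i^+\le u_i^{+\prime}$, $v_i^-\ge v_i^{-\prime}$, $v_i^+\ge v_i^{+\prime}$. Then $$\mathrm{IVq\text{-}ROFHHMGA}_w^{x,y}(a_1,\dots,a_n)\le \mathrm{IVq\text{-}ROFHHMGA}_w^{x,y}(a_1',\dots,a_n').$$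
   Context: Fix a real $q\ge 1$ and a parameter $\varphi>0$. An interval valued $q$-rung orthopair fuzzy number (IVq-ROFN) is a pair $a=\langle[u^-,u^+],[v^-,v^+]\rangle$ of closed subintervals of $[0,1]$ with $(u^+)^q+(v^+)^q\le 1$. Order: the score of $a$ is $S(a)=\frac12\left(u^--v^+(1-u^+)+u^+-v^-(1-u^-)\right)$ and its exact value is $H(a)=\frac12\left[(u^-)^q+(u^+)^q+(v^-)^q+(v^+)^q\right]$. One writes $a_1<a_2$ if $S(a_1)<S(a_2)$, or if $S(a_1)=S(a_2)$ and $H(a_1)<H(a_2)$; $a_1$ and $a_2$ are regarded as equal in the order if $S(a_1)=S(a_2)$ and $H(a_1)=H(a_2)$. Here $a_1\le a_2$ means that $a_1<a_2$ or $a_1,a_2$ are equal in this sense. For real $s,t\in[0,1]$ put $$T(s,t)=\frac{st}{\sqrt[q]{\varphi+(1-\varphi)(s^q+t^q-s^qt^q)}},\qquad C(s,t)=\sqrt[q]{\frac{s^q+t^q-s^qt^q-(1-\varphi)s^qt^q}{1-(1-\varphi)s^qt^q}},$$ and for $\vartheta\ge 0$ (with $0^0=1$) $$M_\vartheta(s)=\sqrt[q]{\frac{(1+(\varphi-1)s^q)^\vartheta-(1-s^q)^\vartheta}{(1+(\varphi-1)s^q)^\vartheta+(\varphi-1)(1-s^q)^\vartheta}},\qquad P_\vartheta(s)=\frac{\sqrt[q]{\varphi}\,s^\vartheta}{\sqrt[q]{(1+(\varphi-1)(1-s^q))^\vartheta+(\varphi-1)(s^q)^\vartheta}}.$$ The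 Hamacher operations on IVq-ROFNs $a_k=\langle[u_k^-,u_k^+],[v_k^-,v_k^+]\rangle$ are $$a_1\oplus_H a_2=\langle[C(u_1^-,u_2^-),C(u_1^+,u_2^+)],[T(v_1^-,v_2^-),T(v_1^+,v_2^+)]\rangle,$$ $$a_1\otimes_H a_2=\langle[T(u_1^-,u_2^-),T(u_1^+,u_2^+)],[C(v_1^-,v_2^-),C(v_1^+,v_2^+)]\rangle,$$ $$\vartheta a=\langle[M_\vartheta(u^-),M_\vartheta(u^+)],[P_\vartheta(v^-),P_\vartheta(v^+)]\rangle,\qquad a^\vartheta=\langle[P_\vartheta(u^-),P_\vartheta(u^+)],[M_\vartheta(v^-),M_\vartheta(v^+)]\rangle.$$ The operator is $$\mathrm{IVq\text{-}ROFHHMGA}_w^{x,y}(a_1,\dots,a_n)=\frac{1}{x+y}\left(\bigoplus_{\substack{H\\ i=1,\,j=1}}^{n}\left(x a_i^{w_i}\otimes_H y a_j^{w_j}\right)^{\frac{2}{n(n+1)}}\right),$$ where the $\oplus_H$-sum runs over all pairs $(i,j)$ with $1\le i,j\le n$ and $x a_i^{w_i}$ means $x(a_i^{w_i})$. *)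

theory Defs
  imports Complex_Main
begin

text \<open>
  The pair of intervals $\langle[u^-,u^+],[v^-,v^+]\rangle$ is given by its four end points, without
  any constraint; the constraints, which depend on $q$, are the predicate \<open>ivqrofn\<close>.
\<close>

datatype ivpair = IVPair (u_lo: real) (u_hi: real) (v_lo: real) (v_hi: real)

definition ivqrofn :: "real \<Rightarrow> ivpair \<Rightarrow> bool" where
  "ivqrofn q a \<longleftrightarrow>
     0 \<le> u_lo a \<and> u_lo a \<le> u_hi a \<and> u_hi a \<le> 1 \<and>
     0 \<le> v_lo a \<and> v_lo a \<le> v_hi a \<and> v_hi a \<le> 1 \<and>
     u_hi a powr q + v_hi a powr q \<le> 1"

definition score :: "ivpair \<Rightarrow> real" where
  "score a = (u_lo a - v_hi a * (1 - u_hi a) + u_hi a - v_lo a * (1 - u_lo a)) / 2"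

definition exact_value :: "real \<Rightarrow> ivpair \<Rightarrow> real" where
  "exact_value q a = (u_lo a powr q + u_hi a powr q + v_lo a powr q + v_hi a powr q) / 2"

definition iv_less :: "real \<Rightarrow> ivpair \<Rightarrow> ivpair \<Rightarrow> bool" where
  "iv_less q a b \<longleftrightarrow>
     score a < score b \<or> score a = score b \<and> exact_value q a < exact_value q b"

definition iv_eq :: "real \<Rightarrow> ivpair \<Rightarrow> ivpair \<Rightarrow> bool" where
  "iv_eq q a b \<longleftrightarrow> score a = score b \<and> exact_value q a = exact_value q b"

definition iv_le :: "real \<Rightarrow> ivpair \<Rightarrow> ivpair \<Rightarrow> bool" where
  "iv_le q a b \<longleftrightarrow> iv_less q a b \<or> iv_eq q a b"

text \<open>
  Powers with an exponent $\vartheta \ge 0$ follow the convention $0^0 = 1$, whereas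
  \<open>0 powr 0 = 0\<close>. The exponents \<open>q\<close> and \<open>1 / q\<close> (the $q$-th root) are positive, so for these
  \<open>powr\<close> is already right on all nonnegative bases.
\<close>

definition rpow :: "real \<Rightarrow> real \<Rightarrow> real" where
  "rpow s \<theta> = (if \<theta> = 0 then 1 else s powr \<theta>)"

definition ham_T :: "real \<Rightarrow> real \<Rightarrow> real \<Rightarrow> real \<Rightarrow> real" where
  "ham_T q \<phi> s t =
     s * t /
     (\<phi> + (1 - \<phi>) * (s powr q + t powr q - s powr q * t powr q)) powr (1 / q)"

definition ham_C :: "real \<Rightarrow> real \<Rightarrow> real \<Rightarrow> real \<Rightarrow> real" where
  "ham_C q \<phi> s t =
     ((s powr q + t powr q - s powr q * t powr q - (1 - \<phi>) * (s powr q * t powr q)) /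
      (1 - (1 - \<phi>) * (s powr q * t powr q))) powr (1 / q)"

definition ham_M :: "real \<Rightarrow> real \<Rightarrow> real \<Rightarrow> real \<Rightarrow> real" where
  "ham_M q \<phi> \<theta> s =
     ((rpow (1 + (\<phi> - 1) * s powr q) \<theta> - rpow (1 - s powr q) \<theta>) /
      (rpow (1 + (\<phi> - 1) * s powr q) \<theta> + (\<phi> - 1) * rpow (1 - s powr q) \<theta>)) powr (1 / q)"

definition ham_P :: "real \<Rightarrow> real \<Rightarrow> real \<Rightarrow> real \<Rightarrow> real" where
  "ham_P q \<phi> \<theta> s =
     \<phi> powr (1 / q) * rpow s \<theta> /
     (rpow (1 + (\<phi> - 1) * (1 - s powr q)) \<theta> + (\<phi> - 1) * rpow (s powr q) \<theta>) powr (1 / q)"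

definition iv_add :: "real \<Rightarrow> real \<Rightarrow> ivpair \<Rightarrow> ivpair \<Rightarrow> ivpair" where
  "iv_add q \<phi> a b =
     IVPair (ham_C q \<phi> (u_lo a) (u_lo b)) (ham_C q \<phi> (u_hi a) (u_hi b))
            (ham_T q \<phi> (v_lo a) (v_lo b)) (ham_T q \<phi> (v_hi a) (v_hi b))"

definition iv_mult :: "real \<Rightarrow> real \<Rightarrow> ivpair \<Rightarrow> ivpair \<Rightarrow> ivpair" where
  "iv_mult q \<phi> a b =
     IVPair (ham_T q \<phi> (u_lo a) (u_lo b)) (ham_T q \<phi> (u_hi a) (u_hi b))
            (ham_C q \<phi> (v_lo a) (v_lo b)) (ham_C q \<phi> (v_hi a) (v_hi b))"

definition iv_scale :: "real \<Rightarrow> real \<Rightarrow> real \<Rightarrow> ivpair \<Rightarrow> ivpair" where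
  "iv_scale q \<phi> \<theta> a =
     IVPair (ham_M q \<phi> \<theta> (u_lo a)) (ham_M q \<phi> \<theta> (u_hi a))
            (ham_P q \<phi> \<theta> (v_lo a)) (ham_P q \<phi> \<theta> (v_hi a))"

definition iv_power :: "real \<Rightarrow> real \<Rightarrow> ivpair \<Rightarrow> real \<Rightarrow> ivpair" where
  "iv_power q \<phi> a \<theta> =
     IVPair (ham_P q \<phi> \<theta> (u_lo a)) (ham_P q \<phi> \<theta> (u_hi a))
            (ham_M q \<phi> \<theta> (v_lo a)) (ham_M q \<phi> \<theta> (v_hi a))"

text \<open>
  The iterated $\oplus_H$-sum of a nonempty list, bracketed to the left and without a neutral
  element. Since $\oplus_H$ is associative and commutative on interval valued $q$-rung orthopair
  fuzzy numbers, the enumeration of the index pairs chosen in \<open>IVqROFHHMGA\<close> is immaterial.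
\<close>

definition iv_sum_list :: "real \<Rightarrow> real \<Rightarrow> ivpair list \<Rightarrow> ivpair" where
  "iv_sum_list q \<phi> as = foldl (iv_add q \<phi>) (hd as) (tl as)"

definition IVqROFHHMGA ::
  "real \<Rightarrow> real \<Rightarrow> real \<Rightarrow> real \<Rightarrow> nat \<Rightarrow> (nat \<Rightarrow> real) \<Rightarrow> (nat \<Rightarrow> ivpair) \<Rightarrow> ivpair" where
  "IVqROFHHMGA q \<phi> x y n w a =
     iv_scale q \<phi> (1 / (x + y))
       (iv_sum_list q \<phi>
         (map (\<lambda>(i, j).
                 iv_power q \<phi>
                   (iv_mult q \<phi>
                     (iv_scale q \<phi> x (iv_power q \<phi> (a i) (w i)))
                     (iv_scale q \<phi> y (iv_power q \<phi> (a j) (w j))))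
                   (2 / (real n * (real n + 1))))
              (List.product [1..<Suc n] [1..<Suc n])))"

end

theory Submission
  imports Defs
begin

text \<open>
  Every operation involved is monotone with respect to the componentwise order, in which a larger
  pair has larger membership and smaller non-membership end points, and the order by score and
  exact value refines the componentwise order. Both parts of this idea need an additional
  observation.

  All operations act separately on the lower end points \<open>(u_lo, v_lo)\<close> and on the upper
  end points \<open>(u_hi, v_hi)\<close>, so it is enough to study a single pair \<open>(u, v)\<close>
  with \<open>u powr q + v powr q \<le> 1\<close>. On \<open>q\<close>-th powers, $T$ and $P_\vartheta$
  become the Hamacher t-norm \<open>hamacher\<close> and its powers \<open>hamacher_pow\<close>, both monotone
  on $[0,1]$, while $C$ and $M_\vartheta$ become their duals under $s \mapsto 1 - s$. Writing the
  constraint as $u^q \le 1 - v^q$, one sees that monotonicity of the t-norm yields not only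
  monotonicity of the operations, but also that they preserve this constraint. Hence the relation
  \<open>orth_le\<close>, which combines the constraint with the componentwise order, is preserved by
  all four operations (\<open>orth_le_T_C\<close>, \<open>orth_le_P_M\<close>, and their mirror images).

  The constraint matters in the last step, \<open>iv_le_if_iv_dom\<close>. The score contribution
  $u - v(1-u)$ is strictly increasing in $u$, but it does not depend on $v$ when $u = 1$. The
  constraint forces $v = 0$ in that case, so that a tie in the score of componentwise comparable
  pairs means that the pairs are equal, and then their exact values agree too.
\<close>

section \<open>The Hamacher t-norm and its powers on the unit interval\<close>

definition hamacher :: "real \<Rightarrow> real \<Rightarrow> real \<Rightarrow> real" where
  "hamacher \<phi> s t = s * t / (\<phi> + (1 - \<phi>) * (s + t - s * t))"

text \<open>
  For a positive integer \<open>\<theta>\<close>, this is the t-norm of \<open>\<theta>\<close> copies of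
  \<open>s\<close>; the formula extends it to real \<open>\<theta>\<close>.
\<close>

definition hamacher_pow :: "real \<Rightarrow> real \<Rightarrow> real \<Rightarrow> real" where
  "hamacher_pow \<phi> \<theta> s =
     \<phi> * rpow s \<theta> / (rpow (1 + (\<phi> - 1) * (1 - s)) \<theta> + (\<phi> - 1) * rpow s \<theta>)"

lemma rpow_nonneg: "0 \<le> rpow s \<theta>"
  by (simp add: rpow_def)

lemma rpow_pos: "0 < s \<Longrightarrow> 0 < rpow s \<theta>"
  by (simp add: rpow_def)

lemma rpow_mono: "0 \<le> s \<Longrightarrow> s \<le> t \<Longrightarrow> 0 \<le> \<theta> \<Longrightarrow> rpow s \<theta> \<le> rpow t \<theta>"
  by (simp add: rpow_def powr_mono2)

lemma rpow_mult: "0 \<le> s \<Longrightarrow> 0 \<le> t \<Longrightarrow> rpow (s * t) \<theta> = rpow s \<theta> * rpow t \<theta>"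
  by (simp add: rpow_def powr_mult)

lemma rpow_powr: "rpow s \<theta> powr q = rpow (s powr q) \<theta>"
  by (simp add: rpow_def powr_powr mult.commute)

text \<open>The denominator is a convex combination of \<open>\<phi>\<close> and \<open>1\<close>.\<close>

lemma hamacher_denom_pos:
  fixes c :: real
  assumes "0 < \<phi>" "0 \<le> c" "c \<le> 1"
  shows "0 < \<phi> + (1 - \<phi>) * c"
proof -
  have "\<phi> + (1 - \<phi>) * c = \<phi> * (1 - c) + c" by (simp add: algebra_simps)
  moreover have "0 < \<phi> * (1 - c) + c"
    using assms by (cases "c = 0") (auto intro: add_nonneg_pos)
  ultimately show ?thesis by simp
qed

lemma prob_sum_unit:
  fixes s t :: real
  assumes "0 \<le> s" "s \<le> 1" "0 \<le> t" "t \<le> 1"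
  shows "0 \<le> s + t - s * t" "s + t - s * t \<le> 1"
proof -
  have "0 \<le> s * (1 - t)" "0 \<le> (1 - s) * (1 - t)"
    using assms by (intro mult_nonneg_nonneg; simp)+
  then show "0 \<le> s + t - s * t" "s + t - s * t \<le> 1"
    using assms by (simp_all add: algebra_simps)
qed

lemma hamacher_nonneg:
  assumes "0 < \<phi>" "0 \<le> s" "s \<le> 1" "0 \<le> t" "t \<le> 1"
  shows "0 \<le> hamacher \<phi> s t"
  using hamacher_denom_pos[OF assms(1) prob_sum_unit[OF assms(2-5)]] assms
  by (simp add: hamacher_def)

lemma hamacher_commute: "hamacher \<phi> s t = hamacher \<phi> t s"
  by (simp add: hamacher_def algebra_simps)

text \<open>
  For fixed \<open>t\<close> the denominator is affine in \<open>s\<close>, so after clearing denominators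
  the terms in \<open>s * s'\<close> cancel and only the constant part \<open>\<phi> + (1 - \<phi>) * t\<close>
  of the denominator remains; that part is positive.
\<close>

lemma hamacher_mono_left:
  assumes "0 < \<phi>" "0 \<le> s" "s \<le> s'" "s' \<le> 1" "0 \<le> t" "t \<le> 1"
  shows "hamacher \<phi> s t \<le> hamacher \<phi> s' t"
proof -
  let ?D = "\<lambda>s. \<phi> + (1 - \<phi>) * (s + t - s * t)"
  have D: "0 < ?D s" "0 < ?D s'"
    using assms by (intro hamacher_denom_pos prob_sum_unit; simp)+
  have "s' * ?D s - s * ?D s' = (s' - s) * (\<phi> + (1 - \<phi>) * t)"
    by (simp add: algebra_simps)
  also have "\<dots> \<ge> 0"
    using assms hamacher_denom_pos[of \<phi> t] by simp
  finally have "t * (s * ?D s') \<le> t * (s' * ?D s)"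
    using assms by (intro mult_left_mono) auto
  then show ?thesis
    unfolding hamacher_def using D by (simp add: divide_le_eq le_divide_eq mult_ac)
qed

lemma hamacher_mono:
  assumes "0 < \<phi>" "0 \<le> s" "s \<le> s'" "s' \<le> 1" "0 \<le> t" "t \<le> t'" "t' \<le> 1"
  shows "hamacher \<phi> s t \<le> hamacher \<phi> s' t'"
proof -
  have "hamacher \<phi> s t \<le> hamacher \<phi> s' t"
    using assms by (intro hamacher_mono_left) auto
  also have "\<dots> \<le> hamacher \<phi> s' t'"
    unfolding hamacher_commute[of \<phi> s'] using assms by (intro hamacher_mono_left) auto
  finally show ?thesis .
qed

lemma hamacher_pow_base_pos:
  fixes s :: real
  assumes "0 < \<phi>" "0 \<le> s" "s \<le> 1"
  shows "0 < 1 + (\<phi> - 1) * (1 - s)"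
  using hamacher_denom_pos[OF assms] by (simp add: algebra_simps)

lemma hamacher_pow_denom_pos:
  assumes "0 < \<phi>" "0 \<le> \<theta>" "0 \<le> s" "s \<le> 1"
  shows "0 < rpow (1 + (\<phi> - 1) * (1 - s)) \<theta> + (\<phi> - 1) * rpow s \<theta>"
    (is "0 < rpow ?A \<theta> + _")
proof -
  have "0 \<le> \<phi> * (1 - s)" using assms by simp
  then have "rpow s \<theta> \<le> rpow ?A \<theta>"
    using assms by (intro rpow_mono) (auto simp: algebra_simps)
  moreover have "0 < rpow ?A \<theta>"
    using assms by (intro rpow_pos hamacher_pow_base_pos)
  moreover have "rpow ?A \<theta> + (\<phi> - 1) * rpow s \<theta> = (rpow ?A \<theta> - rpow s \<theta>) + \<phi> * rpow s \<theta>"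
    by (simp add: algebra_simps)
  moreover have "rpow s \<theta> = 0 \<or> 0 < \<phi> * rpow s \<theta>"
    using rpow_nonneg[of s \<theta>] assms by (auto simp: less_le)
  ultimately show ?thesis
    by (cases "rpow s \<theta> = 0") (simp, linarith)
qed

lemma hamacher_pow_nonneg:
  assumes "0 < \<phi>" "0 \<le> \<theta>" "0 \<le> s" "s \<le> 1"
  shows "0 \<le> hamacher_pow \<phi> \<theta> s"
  using hamacher_pow_denom_pos[OF assms] assms rpow_nonneg[of s \<theta>]
  by (simp add: hamacher_pow_def)

lemma hamacher_pow_one: "\<phi> \<noteq> 0 \<Longrightarrow> hamacher_pow \<phi> \<theta> 1 = 1"
  by (simp add: hamacher_pow_def rpow_def)

text \<open>
  With \<open>A s = 1 + (\<phi> - 1) * (1 - s)\<close>, the power is a decreasing function of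
  \<open>(A s / s) powr \<theta>\<close>, and \<open>A s / s = \<phi> / s - (\<phi> - 1)\<close> decreases in
  \<open>s\<close>. The comparison is carried out in the cross-multiplied form
  \<open>s * A s' \<le> s' * A s\<close>, which also covers \<open>s = 0\<close>.
\<close>

lemma hamacher_pow_mono:
  assumes "0 < \<phi>" "0 \<le> \<theta>" "0 \<le> s" "s \<le> s'" "s' \<le> 1"
  shows "hamacher_pow \<phi> \<theta> s \<le> hamacher_pow \<phi> \<theta> s'"
proof -
  let ?A = "\<lambda>s. 1 + (\<phi> - 1) * (1 - s)"
  let ?D = "\<lambda>s. rpow (?A s) \<theta> + (\<phi> - 1) * rpow s \<theta>"
  have A: "0 < ?A s" "0 < ?A s'"
    using assms by (intro hamacher_pow_base_pos; simp)+
  have D: "0 < ?D s" "0 < ?D s'"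
    using assms by (intro hamacher_pow_denom_pos; simp)+
  have "s' * ?A s - s * ?A s' = \<phi> * (s' - s)"
    by (simp add: algebra_simps)
  also have "\<dots> \<ge> 0" using assms by simp
  finally have "rpow (s * ?A s') \<theta> \<le> rpow (s' * ?A s) \<theta>"
    using assms A by (intro rpow_mono mult_nonneg_nonneg) auto
  then have "rpow s \<theta> * rpow (?A s') \<theta> \<le> rpow s' \<theta> * rpow (?A s) \<theta>"
    using assms A by (simp add: rpow_mult)
  then have "rpow s \<theta> * ?D s' \<le> rpow s' \<theta> * ?D s"
    by (simp add: algebra_simps)
  then have "\<phi> * (rpow s \<theta> * ?D s') \<le> \<phi> * (rpow s' \<theta> * ?D s)"
    using assms by simp
  then show ?thesis
    unfolding hamacher_pow_def using D by (simp add: divide_le_eq le_divide_eq mult_ac)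
qed

section \<open>The four Hamacher functions on q-th powers\<close>

lemma powr_unit:
  fixes s q :: real
  assumes "0 < q" "0 \<le> s" "s \<le> 1"
  shows "0 \<le> s powr q" "s powr q \<le> 1"
  using assms powr_mono2[of q s 1] by auto

lemma powr_root:
  fixes s q :: real
  assumes "0 < q" "0 \<le> s"
  shows "(s powr q) powr (1 / q) = s" "(s powr (1 / q)) powr q = s"
  using assms by (simp_all add: powr_powr)

lemma ham_T_eq:
  assumes "0 < q" "0 \<le> s" "0 \<le> t"
  shows "ham_T q \<phi> s t = hamacher \<phi> (s powr q) (t powr q) powr (1 / q)"
  using assms by (simp add: ham_T_def hamacher_def powr_divide powr_mult powr_root)

lemma ham_C_eq:
  assumes "0 < q" "0 < \<phi>" "0 \<le> s" "s \<le> 1" "0 \<le> t" "t \<le> 1"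
  shows "ham_C q \<phi> s t = (1 - hamacher \<phi> (1 - s powr q) (1 - t powr q)) powr (1 / q)"
proof -
  define S R where "S = s powr q" and "R = t powr q"
  have SR: "0 \<le> S" "S \<le> 1" "0 \<le> R" "R \<le> 1"
    using assms powr_unit by (auto simp: S_def R_def)
  have D: "\<phi> + (1 - \<phi>) * ((1 - S) + (1 - R) - (1 - S) * (1 - R)) = 1 - (1 - \<phi>) * (S * R)"
    by (simp add: algebra_simps)
  have "0 < 1 - (1 - \<phi>) * (S * R)"
    unfolding D[symmetric] using SR assms by (intro hamacher_denom_pos prob_sum_unit) auto
  then have "1 - hamacher \<phi> (1 - S) (1 - R)
      = (S + R - S * R - (1 - \<phi>) * (S * R)) / (1 - (1 - \<phi>) * (S * R))"
    unfolding hamacher_def D by (simp add: field_simps)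
  then show ?thesis
    by (simp add: ham_C_def S_def R_def)
qed

lemma ham_P_eq:
  assumes "0 < q"
  shows "ham_P q \<phi> \<theta> s = hamacher_pow \<phi> \<theta> (s powr q) powr (1 / q)"
proof -
  have "rpow (s powr q) \<theta> powr (1 / q) = rpow s \<theta>"
    using assms rpow_nonneg powr_root(1) by (simp flip: rpow_powr)
  then show ?thesis
    using rpow_nonneg by (simp add: ham_P_def hamacher_pow_def powr_divide powr_mult)
qed

lemma ham_M_eq:
  assumes "0 < q" "0 < \<phi>" "0 \<le> \<theta>" "0 \<le> s" "s \<le> 1"
  shows "ham_M q \<phi> \<theta> s = (1 - hamacher_pow \<phi> \<theta> (1 - s powr q)) powr (1 / q)"
proof -
  have "0 < rpow (1 + (\<phi> - 1) * (1 - (1 - s powr q))) \<theta> + (\<phi> - 1) * rpow (1 - s powr q) \<theta>"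
    using assms powr_unit by (intro hamacher_pow_denom_pos) auto
  then show ?thesis
    by (simp add: ham_M_def hamacher_pow_def field_simps)
qed

section \<open>Comparable orthopairs\<close>

text \<open>
  The constraint is part of the relation because it bounds the arguments of the t-norm and has to
  be known again for the result before the next operation is applied. The relation is invariant
  under exchanging membership and non-membership while reversing the order, which turns each
  statement about \<open>(T, C)\<close> or \<open>(P, M)\<close> into one about \<open>(C, T)\<close> or
  \<open>(M, P)\<close>.
\<close>

definition orth_le :: "real \<Rightarrow> real \<Rightarrow> real \<Rightarrow> real \<Rightarrow> real \<Rightarrow> bool" where
  "orth_le q u v u' v' \<longleftrightarrow>
     0 \<le> u \<and> u \<le> u' \<and> 0 \<le> v' \<and> v' \<le> v \<and>
     u powr q + v powr q \<le> 1 \<and> u' powr q + v' powr q \<le> 1"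

lemma orth_le_swap: "orth_le q v' u' v u \<longleftrightarrow> orth_le q u v u' v'"
  by (auto simp: orth_le_def add.commute)

lemma le_one_if_powr_le_one:
  fixes s q :: real
  assumes "0 < q" "s powr q \<le> 1"
  shows "s \<le> 1"
  using assms gr_one_powr[of s q] by linarith

lemma orth_le_unit:
  assumes "0 < q" "orth_le q u v u' v'"
  shows "0 \<le> u" "u \<le> 1" "0 \<le> v" "v \<le> 1" "0 \<le> u'" "u' \<le> 1" "0 \<le> v'" "v' \<le> 1"
proof -
  have "u powr q \<le> 1" "v powr q \<le> 1" "u' powr q \<le> 1" "v' powr q \<le> 1"
    using assms(2) powr_ge_zero[of u q] powr_ge_zero[of v q] powr_ge_zero[of u' q]
      powr_ge_zero[of v' q]
    unfolding orth_le_def by linarith+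
  then show "0 \<le> u" "u \<le> 1" "0 \<le> v" "v \<le> 1" "0 \<le> u'" "u' \<le> 1" "0 \<le> v'" "v' \<le> 1"
    using assms le_one_if_powr_le_one by (auto simp: orth_le_def)
qed

lemma orth_le_powr:
  assumes "0 < q" "orth_le q u v u' v'"
  shows "0 \<le> u powr q" "u powr q \<le> u' powr q" "u powr q \<le> 1 - v powr q"
    "u' powr q \<le> 1 - v' powr q" "1 - v powr q \<le> 1 - v' powr q" "1 - v' powr q \<le> 1"
  using assms by (auto simp: orth_le_def powr_mono2)

text \<open>
  In terms of $X = u^q$ and $Y = 1 - v^q$, the relation \<open>orth_le\<close> is a square of
  inequalities in the unit interval. A monotone map sends such a square to another one.
\<close>

lemma orth_le_roots:
  assumes "0 < q" "0 \<le> X" "X \<le> X'" "X \<le> Y" "X' \<le> Y'" "Y \<le> Y'" "Y' \<le> 1"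
  shows "orth_le q (X powr (1 / q)) ((1 - Y) powr (1 / q))
                   (X' powr (1 / q)) ((1 - Y') powr (1 / q))"
  using assms by (auto simp: orth_le_def powr_root intro!: powr_mono2)

lemma orth_le_T_C:
  assumes q: "0 < q" and \<phi>: "0 < \<phi>"
    and le1: "orth_le q u1 v1 u1' v1'" and le2: "orth_le q u2 v2 u2' v2'"
  shows "orth_le q (ham_T q \<phi> u1 u2) (ham_C q \<phi> v1 v2) (ham_T q \<phi> u1' u2') (ham_C q \<phi> v1' v2')"
proof -
  note unit = orth_le_unit[OF q le1] orth_le_unit[OF q le2]
  note powr = orth_le_powr[OF q le1] orth_le_powr[OF q le2]
  have "hamacher \<phi> (1 - v1' powr q) (1 - v2' powr q) \<le> hamacher \<phi> 1 1"
    using \<phi> powr by (intro hamacher_mono) linarith+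
  then have "hamacher \<phi> (1 - v1' powr q) (1 - v2' powr q) \<le> 1"
    by (simp add: hamacher_def)
  moreover have "0 \<le> hamacher \<phi> (u1 powr q) (u2 powr q)"
    using \<phi> powr by (intro hamacher_nonneg) linarith+
  ultimately show ?thesis
    unfolding ham_T_eq[OF q unit(1) unit(9)] ham_T_eq[OF q unit(5) unit(13)]
      ham_C_eq[OF q \<phi> unit(3,4) unit(11,12)] ham_C_eq[OF q \<phi> unit(7,8) unit(15,16)]
    using q \<phi> powr by (intro orth_le_roots hamacher_mono) linarith+
qed

lemma orth_le_C_T:
  assumes "0 < q" "0 < \<phi>" "orth_le q u1 v1 u1' v1'" "orth_le q u2 v2 u2' v2'"
  shows "orth_le q (ham_C q \<phi> u1 u2) (ham_T q \<phi> v1 v2) (ham_C q \<phi> u1' u2') (ham_T q \<phi> v1' v2')"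
  using assms orth_le_T_C orth_le_swap by metis

lemma orth_le_P_M:
  assumes q: "0 < q" and \<phi>: "0 < \<phi>" and \<theta>: "0 \<le> \<theta>" and le: "orth_le q u v u' v'"
  shows "orth_le q (ham_P q \<phi> \<theta> u) (ham_M q \<phi> \<theta> v) (ham_P q \<phi> \<theta> u') (ham_M q \<phi> \<theta> v')"
proof -
  note unit = orth_le_unit[OF q le]
  note powr = orth_le_powr[OF q le]
  have "hamacher_pow \<phi> \<theta> (1 - v' powr q) \<le> hamacher_pow \<phi> \<theta> 1"
    using \<phi> \<theta> powr by (intro hamacher_pow_mono) linarith+
  then have "hamacher_pow \<phi> \<theta> (1 - v' powr q) \<le> 1"
    using \<phi> by (simp add: hamacher_pow_one)
  moreover have "0 \<le> hamacher_pow \<phi> \<theta> (u powr q)"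
    using \<phi> \<theta> powr by (intro hamacher_pow_nonneg) linarith+
  ultimately show ?thesis
    unfolding ham_P_eq[OF q] ham_M_eq[OF q \<phi> \<theta> unit(3,4)] ham_M_eq[OF q \<phi> \<theta> unit(7,8)]
    using q \<phi> \<theta> powr by (intro orth_le_roots hamacher_pow_mono) linarith+
qed

lemma orth_le_M_P:
  assumes "0 < q" "0 < \<phi>" "0 \<le> \<theta>" "orth_le q u v u' v'"
  shows "orth_le q (ham_M q \<phi> \<theta> u) (ham_P q \<phi> \<theta> v) (ham_M q \<phi> \<theta> u') (ham_P q \<phi> \<theta> v')"
  using assms orth_le_P_M orth_le_swap by metis

section \<open>Comparable interval pairs\<close>

text \<open>
  Score, exact value and all operations treat the lower and the upper end points independently,
  so comparability is a condition on each of the two orthopairs.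
\<close>

definition iv_dom :: "real \<Rightarrow> ivpair \<Rightarrow> ivpair \<Rightarrow> bool" where
  "iv_dom q a b \<longleftrightarrow>
     orth_le q (u_lo a) (v_lo a) (u_lo b) (v_lo b) \<and>
     orth_le q (u_hi a) (v_hi a) (u_hi b) (v_hi b)"

lemma iv_dom_add:
  "0 < q \<Longrightarrow> 0 < \<phi> \<Longrightarrow> iv_dom q a a' \<Longrightarrow> iv_dom q b b' \<Longrightarrow>
    iv_dom q (iv_add q \<phi> a b) (iv_add q \<phi> a' b')"
  by (simp add: iv_dom_def iv_add_def orth_le_C_T)

lemma iv_dom_mult:
  "0 < q \<Longrightarrow> 0 < \<phi> \<Longrightarrow> iv_dom q a a' \<Longrightarrow> iv_dom q b b' \<Longrightarrow>
    iv_dom q (iv_mult q \<phi> a b) (iv_mult q \<phi> a' b')"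
  by (simp add: iv_dom_def iv_mult_def orth_le_T_C)

lemma iv_dom_scale:
  "0 < q \<Longrightarrow> 0 < \<phi> \<Longrightarrow> 0 \<le> \<theta> \<Longrightarrow> iv_dom q a a' \<Longrightarrow>
    iv_dom q (iv_scale q \<phi> \<theta> a) (iv_scale q \<phi> \<theta> a')"
  by (simp add: iv_dom_def iv_scale_def orth_le_M_P)

lemma iv_dom_power:
  "0 < q \<Longrightarrow> 0 < \<phi> \<Longrightarrow> 0 \<le> \<theta> \<Longrightarrow> iv_dom q a a' \<Longrightarrow>
    iv_dom q (iv_power q \<phi> a \<theta>) (iv_power q \<phi> a' \<theta>)"
  by (simp add: iv_dom_def iv_power_def orth_le_P_M)

lemma iv_dom_foldl_add:
  assumes "0 < q" "0 < \<phi>" "list_all2 (iv_dom q) as bs" "iv_dom q a b"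
  shows "iv_dom q (foldl (iv_add q \<phi>) a as) (foldl (iv_add q \<phi>) b bs)"
  using assms(3,4)
  by (induction arbitrary: a b rule: list_all2_induct) (use assms(1,2) in \<open>auto intro: iv_dom_add\<close>)

lemma iv_dom_sum_list:
  assumes "0 < q" "0 < \<phi>" "list_all2 (iv_dom q) as bs" "as \<noteq> []"
  shows "iv_dom q (iv_sum_list q \<phi> as) (iv_sum_list q \<phi> bs)"
  using assms by (cases as; cases bs) (auto simp: iv_sum_list_def intro: iv_dom_foldl_add)

lemma iv_dom_IVqROFHHMGA:
  assumes "0 < q" "0 < \<phi>" "0 \<le> x" "0 \<le> y" "n \<noteq> 0"
    and "\<And>i. i \<in> {1..n} \<Longrightarrow> 0 \<le> w i" and "\<And>i. i \<in> {1..n} \<Longrightarrow> iv_dom q (a i) (a' i)"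
  shows "iv_dom q (IVqROFHHMGA q \<phi> x y n w a) (IVqROFHHMGA q \<phi> x y n w a')"
proof -
  have "List.product [1..<Suc n] [1..<Suc n] \<noteq> []"
    using assms(5) by (simp flip: length_0_conv del: upt_Suc)
  then show ?thesis
    unfolding IVqROFHHMGA_def using assms
    by (intro iv_dom_scale iv_dom_sum_list)
      (auto simp: list.rel_map intro!: list.rel_refl_strong iv_dom_power iv_dom_mult iv_dom_scale)
qed

section \<open>Comparable interval pairs in the order by score and exact value\<close>

text \<open>
  The difference of the two sides is $(u' - u)(1 + v) + (v - v')(1 - u')$, a sum of
  nonnegative terms. If it vanishes, then $u = u'$, and either $v = v'$ or $u' = 1$; in the latter
  case the constraint makes both $v$ and $v'$ zero.
\<close>

lemma orth_le_score:
  assumes "0 < q" "orth_le q u v u' v'"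
  shows "u - v * (1 - u) \<le> u' - v' * (1 - u')"
    and "u - v * (1 - u) = u' - v' * (1 - u') \<Longrightarrow> u = u' \<and> v = v'"
proof -
  note unit = orth_le_unit[OF assms]
  have le: "u \<le> u'" "v' \<le> v" and vq: "u powr q + v powr q \<le> 1"
    using assms by (auto simp: orth_le_def)
  have diff: "(u' - v' * (1 - u')) - (u - v * (1 - u)) = (u' - u) * (1 + v) + (v - v') * (1 - u')"
    by (simp add: algebra_simps)
  have nonneg: "0 \<le> (u' - u) * (1 + v)" "0 \<le> (v - v') * (1 - u')"
    using le unit by (intro mult_nonneg_nonneg; simp)+
  show "u - v * (1 - u) \<le> u' - v' * (1 - u')"
    using diff nonneg by linarith
  assume "u - v * (1 - u) = u' - v' * (1 - u')"
  with diff nonneg have zero: "(u' - u) * (1 + v) = 0" "(v - v') * (1 - u') = 0"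
    by linarith+
  from zero(1) unit have "u = u'" by auto
  moreover have "v = v'"
  proof (cases "u' = 1")
    case True
    with \<open>u = u'\<close> vq have "v = 0" by auto
    with le unit show ?thesis by simp
  qed (use zero(2) in auto)
  ultimately show "u = u' \<and> v = v'" by simp
qed

lemma iv_le_if_iv_dom:
  assumes "0 < q" "iv_dom q a b"
  shows "iv_le q a b"
proof -
  note lo = orth_le_score[OF assms(1) conjunct1[OF assms(2)[unfolded iv_dom_def]]]
  note hi = orth_le_score[OF assms(1) conjunct2[OF assms(2)[unfolded iv_dom_def]]]
  have le: "score a \<le> score b"
    using lo(1) hi(1) by (simp add: score_def)
  have "a = b" if "score a = score b"
  proof -
    from that lo(1) hi(1) have
      "u_lo a - v_lo a * (1 - u_lo a) = u_lo b - v_lo b * (1 - u_lo b)"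
      "u_hi a - v_hi a * (1 - u_hi a) = u_hi b - v_hi b * (1 - u_hi b)"
      by (simp_all add: score_def)
    with lo(2) hi(2) show "a = b"
      by (simp add: ivpair.expand)
  qed
  with le show ?thesis
    by (auto simp: iv_le_def iv_less_def iv_eq_def)
qed

section \<open>Monotonicity of the aggregation operator\<close>

lemma ivqrofn_lo:
  assumes "0 < q" "ivqrofn q a"
  shows "u_lo a powr q + v_lo a powr q \<le> 1"
proof -
  have "u_lo a powr q \<le> u_hi a powr q" "v_lo a powr q \<le> v_hi a powr q"
    using assms by (auto simp: ivqrofn_def intro: powr_mono2)
  then show ?thesis
    using assms(2) by (simp add: ivqrofn_def)
qed

lemma iv_dom_if_ivqrofn:
  assumes "0 < q" "ivqrofn q a" "ivqrofn q b"
    and "u_lo a \<le> u_lo b" "u_hi a \<le> u_hi b" "v_lo b \<le> v_lo a" "v_hi b \<le> v_hi a"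
  shows "iv_dom q a b"
  using assms ivqrofn_lo[OF assms(1,2)] ivqrofn_lo[OF assms(1,3)]
  by (auto simp: iv_dom_def orth_le_def ivqrofn_def)

theorem theorem12:
  fixes q \<phi> x y :: real and n :: nat
    and w :: "nat \<Rightarrow> real" and a a' :: "nat \<Rightarrow> ivpair"
  assumes "q \<ge> 1" and "\<phi> > 0"
    and "x \<ge> 0" and "y \<ge> 0" and "\<not> (x = 0 \<and> y = 0)"
    and "\<forall>i\<in>{1..n}. 0 \<le> w i \<and> w i \<le> 1" and "(\<Sum>i=1..n. w i) = 1"
    and "\<forall>i\<in>{1..n}. ivqrofn q (a i)" and "\<forall>i\<in>{1..n}. ivqrofn q (a' i)"
    and "\<forall>i\<in>{1..n}. u_lo (a i) \<le> u_lo (a' i) \<and> u_hi (a i) \<le> u_hi (a' i) \<and>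
                    v_lo (a i) \<ge> v_lo (a' i) \<and> v_hi (a i) \<ge> v_hi (a' i)"
  shows "iv_le q (IVqROFHHMGA q \<phi> x y n w a) (IVqROFHHMGA q \<phi> x y n w a')"
proof -
  have q: "0 < q" using assms(1) by simp
  have "n \<noteq> 0" using assms(7) by (intro notI) simp
  moreover have "iv_dom q (a i) (a' i)" if "i \<in> {1..n}" for i
    using q assms(8-10) that by (blast intro: iv_dom_if_ivqrofn)
  ultimately have "iv_dom q (IVqROFHHMGA q \<phi> x y n w a) (IVqROFHHMGA q \<phi> x y n w a')"
    using q assms(2-4,6) by (intro iv_dom_IVqROFHHMGA) auto
  with q show ?thesis by (rule iv_le_if_iv_dom)
qed

end
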